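(* Let $f=f(x_i,x_j,y)$ be the (bounded) joint density of $(X_i,X_j,Y)$, $i\neq j$, and let $\hat f$ be a (bounded) preliminary estimator of $f$. Put $F(u)=T_{ij}(uf+(1-u)\hat f)$ for $u\in[0,1]$. Then the following decomposition holds: $$T_{ij}(f)=\int H_1(\hat f,x_i,x_j,y)\,f(x_i,x_j,y)\,dx_i\,dx_j\,dy+\int H_2(\hat f,x_{i1},x_{j2},y)\,f(x_{i1},x_{j1},y)\,f(x_{i2},x_{j2},y)\,dx_{i1}\,dx_{j1}\,dx_{i2}\,dx_{j2}\,dy+\Gamma_n,$$ where $$H_1(\hat f,x_i,x_j,y)=x_i\,m_j(\hat f,y)+x_j\,m_i(\hat f,y)-m_i(\hat f,y)\,m_j(\hat f,y),$$ $$H_2(\hat f,x_{i1},x_{j2},y)=\frac{1}{\int\hat f(x_i,x_j,y)\,dx_i\,dx_j}\,\bigl(x_{i1}-m_i(\hat f,y)\bigr)\bigl(x_{j2}-m_j(\hat f,y)\bigr),$$ $$\Gamma_n=\tfrac16\,F'''(\xi)\,(1-\xi)^3,$$ for some $\xi\in\,]0,1[$.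
   Context: $X\in\mathbb R^p$ is a square integrable, centered random vector with coordinates $X_1,\dots,X_p$, and $Y\in\mathbb R$ is a random variable. The estimator $\hat f$ is built from a subsample of size $n_1<n$ of an i.i.d. sample of size $n$ of $(X_i,X_j,Y)$. For a square integrable function $\psi(x_i,x_j,y)$ define $$m_i(\psi,y)=\frac{\int x_i\,\psi(x_i,x_j,y)\,dx_i\,dx_j}{\int\psi(x_i,x_j,y)\,dx_i\,dx_j},\qquad m_j(\psi,y)=\frac{\int x_j\,\psi(x_i,x_j,y)\,dx_i\,dx_j}{\int\psi(x_i,x_j,y)\,dx_i\,dx_j},$$ and $$T_{ij}(\psi)=\int m_i(\psi,y)\,m_j(\psi,y)\,\psi(x_i,x_j,y)\,dx_i\,dx_j\,dy .$$ For $\psi=f$, $T_{ij}(f)=\mathbb E[\mathbb E[X_i\mid Y]\,\mathbb E[X_j\mid Y]]$.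
   Formalization: The remainder is taken as Γ_n = F'''(ξ)/6 without the factor (1−ξ)³, with which the claim is false; it is also made explicit that ∫f̂ dx_i dx_j > 0 wherever f_Y > 0 and that m_i(f̂), m_j(f̂), F(u) and the two integrals are well defined. *)

theory Defs
  imports "HOL-Probability.Probability"
begin

text \<open>A function \<open>\<psi>\<close> of \<open>(x\<^sub>i, x\<^sub>j, y)\<close> is a function on
  \<^typ>\<open>real \<times> real \<times> real\<close>; \<^const>\<open>lborel\<close> on a product of copies of
  \<^typ>\<open>real\<close> is the Lebesgue measure of that product.\<close>

definition marginal_y :: "(real \<times> real \<times> real \<Rightarrow> real) \<Rightarrow> real \<Rightarrow> real" where
  "marginal_y \<psi> y = (\<integral>(xi, xj). \<psi> (xi, xj, y) \<partial>(lborel :: (real \<times> real) measure))"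

definition m_i :: "(real \<times> real \<times> real \<Rightarrow> real) \<Rightarrow> real \<Rightarrow> real" where
  "m_i \<psi> y =
     (\<integral>(xi, xj). xi * \<psi> (xi, xj, y) \<partial>(lborel :: (real \<times> real) measure)) / marginal_y \<psi> y"

definition m_j :: "(real \<times> real \<times> real \<Rightarrow> real) \<Rightarrow> real \<Rightarrow> real" where
  "m_j \<psi> y =
     (\<integral>(xi, xj). xj * \<psi> (xi, xj, y) \<partial>(lborel :: (real \<times> real) measure)) / marginal_y \<psi> y"

definition T_integrand :: "(real \<times> real \<times> real \<Rightarrow> real) \<Rightarrow> real \<times> real \<times> real \<Rightarrow> real" where
  "T_integrand \<psi> = (\<lambda>(xi, xj, y). m_i \<psi> y * m_j \<psi> y * \<psi> (xi, xj, y))"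

definition T_ij :: "(real \<times> real \<times> real \<Rightarrow> real) \<Rightarrow> real" where
  "T_ij \<psi> = (\<integral>z. T_integrand \<psi> z \<partial>lborel)"

definition mix ::
  "(real \<times> real \<times> real \<Rightarrow> real) \<Rightarrow> (real \<times> real \<times> real \<Rightarrow> real) \<Rightarrow> real \<Rightarrow>
   real \<times> real \<times> real \<Rightarrow> real" where
  "mix f g u = (\<lambda>z. u * f z + (1 - u) * g z)"

definition F_path ::
  "(real \<times> real \<times> real \<Rightarrow> real) \<Rightarrow> (real \<times> real \<times> real \<Rightarrow> real) \<Rightarrow> real \<Rightarrow> real" where
  "F_path f g u = T_ij (mix f g u)"

definition H1 :: "(real \<times> real \<times> real \<Rightarrow> real) \<Rightarrow> real \<Rightarrow> real \<Rightarrow> real \<Rightarrow> real" where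
  "H1 g xi xj y = xi * m_j g y + xj * m_i g y - m_i g y * m_j g y"

definition H2 :: "(real \<times> real \<times> real \<Rightarrow> real) \<Rightarrow> real \<Rightarrow> real \<Rightarrow> real \<Rightarrow> real" where
  "H2 g xi1 xj2 y = 1 / marginal_y g y * (xi1 - m_i g y) * (xj2 - m_j g y)"

definition H1_integrand ::
  "(real \<times> real \<times> real \<Rightarrow> real) \<Rightarrow> (real \<times> real \<times> real \<Rightarrow> real) \<Rightarrow>
   real \<times> real \<times> real \<Rightarrow> real" where
  "H1_integrand f g = (\<lambda>(xi, xj, y). H1 g xi xj y * f (xi, xj, y))"

text \<open>Variables in the order \<open>(x\<^sub>i\<^sub>1, x\<^sub>j\<^sub>1, x\<^sub>i\<^sub>2, x\<^sub>j\<^sub>2, y)\<close>.\<close>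

definition H2_integrand ::
  "(real \<times> real \<times> real \<Rightarrow> real) \<Rightarrow> (real \<times> real \<times> real \<Rightarrow> real) \<Rightarrow>
   real \<times> real \<times> real \<times> real \<times> real \<Rightarrow> real" where
  "H2_integrand f g =
     (\<lambda>(xi1, xj1, xi2, xj2, y). H2 g xi1 xj2 y * f (xi1, xj1, y) * f (xi2, xj2, y))"

text \<open>The Lagrange remainder at \<open>1\<close> of the second order Taylor expansion at \<open>0\<close> of
  \<open>F = F_path f g\<close>, that is \<open>1/6 F'''(\<xi>) (1 - 0)\<^sup>3\<close>. In the literature it is
  printed with the factor \<open>(1 - \<xi>)\<^sup>3\<close>, and the decomposition is then false: let
  \<open>y\<close> range over \<open>[0,2]\<close>, let \<open>f\<close> and \<open>g\<close> have \<open>y\<close>-marginals \<open>1/4\<close> and \<open>1/2\<close> on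
  \<open>[0,1]\<close>, \<open>3/4\<close> and \<open>1/2\<close> on \<open>[1,2]\<close>, and let \<open>(x\<^sub>i, x\<^sub>j)\<close> given \<open>y\<close> be uniform on
  a unit square with centre \<open>(3,3)\<close> under \<open>f\<close> and \<open>(0,0)\<close> under \<open>g\<close> for \<open>y\<close> in \<open>[0,1]\<close>,
  \<open>(-1,-1)\<close> under both for \<open>y\<close> in \<open>[1,2]\<close>. The remainder is \<open>9/8\<close> and
  \<open>1/6 F'''(\<xi>) = 9/16 (1 - \<xi>/2)\<^sup>-\<^sup>4\<close>, while \<open>9/16 (1 - \<xi>)\<^sup>3 (1 - \<xi>/2)\<^sup>-\<^sup>4 < 9/16\<close>
  on \<open>]0,1[\<close>.\<close>

definition Gamma_rem ::
  "(real \<times> real \<times> real \<Rightarrow> real) \<Rightarrow> (real \<times> real \<times> real \<Rightarrow> real) \<Rightarrow> real \<Rightarrow> real" where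
  "Gamma_rem f g \<xi> = 1 / 6 * (deriv ^^ 3) (F_path f g) \<xi>"

definition iid_sample ::
  "'a measure \<Rightarrow> ('a \<Rightarrow> 'b :: topological_space) \<Rightarrow> nat \<Rightarrow> (nat \<Rightarrow> 'a \<Rightarrow> 'b) \<Rightarrow> bool" where
  "iid_sample M V n Z \<longleftrightarrow>
     prob_space.indep_vars M (\<lambda>_. borel) Z {..<n} \<and>
     (\<forall>k<n. distr M borel (Z k) = distr M borel V)"

end

theory Submission
  imports Defs
begin

text \<open>Fix \<open>y\<close>, let \<open>p\<close>, \<open>q\<close> be the marginals of \<open>f\<close>, \<open>fhat\<close> at \<open>y\<close> and \<open>t = p / q\<close>. Integrating
  \<open>T_integrand (mix f fhat u)\<close> over \<open>(x\<^sub>i, x\<^sub>j)\<close> gives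
  \<open>A\<^sub>0 + A\<^sub>1 u + E u\<^sup>2 / (1 - u + u t)\<close>, where \<open>A\<^sub>0 + A\<^sub>1\<close> and \<open>E\<close> are the inner integrals of the
  \<open>H1\<close> and \<open>H2\<close> integrands; where \<open>p = 0\<close> this holds with \<open>E = 0\<close> and \<open>A\<^sub>1 = - A\<^sub>0\<close>. On compact
  subintervals of \<open>]0,1[\<close> the first three derivatives in \<open>u\<close> of \<open>u\<^sup>2 / (1 - u + u t)\<close> are bounded
  uniformly in \<open>t > 0\<close> (the first two even up to \<open>u = 0\<close>), so integrability of \<open>E\<close> alone permits
  differentiation under the integral. Integrability of \<open>E / t\<close>, read off at \<open>u = 1\<close>, gives continuity
  of \<open>F\<close> at \<open>1\<close>, and Rolle's theorem applied three times yields the remainder.\<close>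

section \<open>Differentiation under the integral sign\<close>

text \<open>On the convex set \<open>S\<close> the mean value inequality bounds every difference
  quotient by \<open>B y\<close>, so dominated convergence applies along each sequence tending to
  \<open>u\<close>.\<close>

lemma has_real_derivative_integral_dominated:
  fixes h h' :: "real \<Rightarrow> 'a \<Rightarrow> real"
  assumes "convex S" and "u \<in> S"
    and int: "\<And>v. v \<in> S \<Longrightarrow> integrable M (h v)"
    and der: "\<And>v y. v \<in> S \<Longrightarrow> ((\<lambda>v. h v y) has_real_derivative h' v y) (at v within S)"
    and [measurable]: "h' u \<in> borel_measurable M"
    and bound: "\<And>v y. v \<in> S \<Longrightarrow> \<bar>h' v y\<bar> \<le> B y"
    and B: "integrable M B"
  shows "((\<lambda>v. \<integral>y. h v y \<partial>M) has_real_derivative (\<integral>y. h' u y \<partial>M)) (at u within S)"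
  unfolding has_field_derivative_iff tendsto_at_iff_sequentially comp_def
proof (intro allI impI)
  fix X :: "nat \<Rightarrow> real"
  assume X: "\<forall>i. X i \<in> S - {u}" and lim: "X \<longlonglongrightarrow> u"
  have [measurable]: "h (X k) \<in> borel_measurable M" "h u \<in> borel_measurable M" for k
    using int[of "X k"] int[of u] X \<open>u \<in> S\<close> by auto
  have "(\<lambda>k. \<integral>y. (h (X k) y - h u y) / (X k - u) \<partial>M) \<longlonglongrightarrow> (\<integral>y. h' u y \<partial>M)"
  proof (rule integral_dominated_convergence[OF _ _ B])
    show "AE y in M. (\<lambda>k. (h (X k) y - h u y) / (X k - u)) \<longlonglongrightarrow> h' u y"
      using der[OF \<open>u \<in> S\<close>] X lim
      unfolding has_field_derivative_iff tendsto_at_iff_sequentially comp_def by auto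
    show "AE y in M. norm ((h (X k) y - h u y) / (X k - u)) \<le> B y" for k
    proof (rule AE_I2)
      fix y
      have "norm (h (X k) y - h u y) \<le> B y * norm (X k - u)"
        using field_differentiable_bound[OF \<open>convex S\<close>, of "\<lambda>v. h v y" "\<lambda>v. h' v y" "B y" "X k" u]
          der bound X \<open>u \<in> S\<close> by auto
      then show "norm ((h (X k) y - h u y) / (X k - u)) \<le> B y"
        using X by (auto simp: field_simps abs_mult)
    qed
  qed measurable
  moreover have "(\<integral>y. (h (X k) y - h u y) / (X k - u) \<partial>M)
      = ((\<integral>y. h (X k) y \<partial>M) - (\<integral>y. h u y \<partial>M)) / (X k - u)" for k
    using int[of "X k"] int[of u] X \<open>u \<in> S\<close> by simp
  ultimately show "(\<lambda>k. ((\<integral>y. h (X k) y \<partial>M) - (\<integral>y. h u y \<partial>M)) / (X k - u))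
      \<longlonglongrightarrow> (\<integral>y. h' u y \<partial>M)" by (simp only:)
qed

section \<open>Taylor's formula with Lagrange remainder, and iterated derivatives\<close>

text \<open>Rolle's theorem is applied to \<open>F\<close> minus a cubic and to the first two
  derivatives of that difference, and it asks only for continuity at endpoints. This matters in the
  application: the available bounds fail at 0 for the third derivative and at 1 for all
  derivatives.\<close>

lemma Taylor_Lagrange_order3_unit_interval:
  fixes F F1 F2 F3 :: "real \<Rightarrow> real"
  assumes cont: "continuous_on {0..1} F" "continuous_on {0..<1} F1" "continuous_on {0..<1} F2"
    and der: "\<And>u. u \<in> {0<..<1} \<Longrightarrow> (F has_real_derivative F1 u) (at u)"
      "\<And>u. u \<in> {0<..<1} \<Longrightarrow> (F1 has_real_derivative F2 u) (at u)"
      "\<And>u. u \<in> {0<..<1} \<Longrightarrow> (F2 has_real_derivative F3 u) (at u)"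
  shows "\<exists>\<xi>\<in>{0<..<1}. F 1 = F 0 + F1 0 + F2 0 / 2 + F3 \<xi> / 6"
proof -
  \<comment> \<open>\<open>C\<close> is the remainder to be identified. As coefficient of the cubic
    term it makes \<open>G 1 = G 0\<close>, and it enters the third derivative of \<open>G\<close>
    as \<open>- 6 * C\<close>.\<close>
  define C where "C = F 1 - F 0 - F1 0 - F2 0 / 2"
  define G where "G u = F u - F 0 - F1 0 * u - F2 0 / 2 * u\<^sup>2 - C * u ^ 3" for u
  define G1 where "G1 u = F1 u - F1 0 - F2 0 * u - 3 * C * u\<^sup>2" for u
  define G2 where "G2 u = F2 u - F2 0 - 6 * C * u" for u
  have dG: "(G has_real_derivative G1 u) (at u)" if "u \<in> {0<..<1}" for u
    unfolding G_def G1_def by (auto intro!: derivative_eq_intros der that)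
  have dG1: "(G1 has_real_derivative G2 u) (at u)" if "u \<in> {0<..<1}" for u
    unfolding G1_def G2_def by (auto intro!: derivative_eq_intros der that)
  have dG2: "(G2 has_real_derivative F3 u - 6 * C) (at u)" if "u \<in> {0<..<1}" for u
    unfolding G2_def by (auto intro!: derivative_eq_intros der that)
  have "\<exists>z. 0 < z \<and> z < 1 \<and> ((*) (G1 z)) = (\<lambda>v. 0)"
  proof (rule Rolle_deriv)
    show "continuous_on {0..1} G"
      unfolding G_def by (intro continuous_intros cont)
    show "G 0 = G 1" by (simp add: G_def C_def)
  qed (use dG in \<open>auto simp: has_field_derivative_def\<close>)
  then obtain a where a: "0 < a" "a < 1" "G1 a = 0" by (auto simp: fun_eq_iff)
  \<comment> \<open>From here on the right endpoints are zeros below 1, so the intervals stay where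
    \<open>F1\<close> and \<open>F2\<close> are assumed continuous.\<close>
  have "\<exists>z. 0 < z \<and> z < a \<and> ((*) (G2 z)) = (\<lambda>v. 0)"
  proof (rule Rolle_deriv)
    show "continuous_on {0..a} G1"
      unfolding G1_def using a
      by (intro continuous_intros continuous_on_subset[OF cont(2)]) auto
    show "G1 0 = G1 a" using a by (simp add: G1_def)
  qed (use dG1 a in \<open>auto simp: has_field_derivative_def\<close>)
  then obtain b where b: "0 < b" "b < a" "G2 b = 0" by (auto simp: fun_eq_iff)
  have "\<exists>z. 0 < z \<and> z < b \<and> ((*) (F3 z - 6 * C)) = (\<lambda>v. 0)"
  proof (rule Rolle_deriv)
    show "continuous_on {0..b} G2"
      unfolding G2_def using a b
      by (intro continuous_intros continuous_on_subset[OF cont(3)]) auto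
    show "G2 0 = G2 b" using b by (simp add: G2_def)
  qed (use dG2 a b in \<open>auto simp: has_field_derivative_def\<close>)
  then obtain c where "0 < c" "c < b" "F3 c = 6 * C" by (auto simp: fun_eq_iff)
  then show ?thesis using a b by (intro bexI[of _ c]) (auto simp: C_def field_simps)
qed

text \<open>\<open>deriv\<close> at a point sees the function on a whole neighbourhood, so the
  induction runs on an open set where \<open>F\<close> agrees with \<open>D 0\<close>.\<close>

lemma iterated_deriv_eq:
  fixes F :: "real \<Rightarrow> real" and D :: "nat \<Rightarrow> real \<Rightarrow> real"
  assumes "open S" and F: "\<And>u. u \<in> S \<Longrightarrow> F u = D 0 u"
    and D: "\<And>k u. k < n \<Longrightarrow> u \<in> S \<Longrightarrow> (D k has_real_derivative D (Suc k) u) (at u)"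
  shows "k \<le> n \<Longrightarrow> u \<in> S \<Longrightarrow> (deriv ^^ k) F u = D k u"
proof (induction k arbitrary: u)
  case (Suc k)
  have "((deriv ^^ k) F has_real_derivative D (Suc k) u) (at u)"
    by (rule has_field_derivative_transform_within_open[OF D \<open>open S\<close>]) (use Suc in auto)
  then show ?case by (simp add: DERIV_imp_deriv)
qed (simp add: F)

text \<open>Because \<open>deriv\<close> is total, an equation for its value does not show that a
  derivative exists; existence is inherited from the explicit \<open>D\<close>.\<close>

lemma has_real_derivative_iterated_deriv:
  fixes F :: "real \<Rightarrow> real" and D :: "nat \<Rightarrow> real \<Rightarrow> real"
  assumes "open S" and F: "\<And>u. u \<in> S \<Longrightarrow> F u = D 0 u"
    and D: "\<And>k u. k < n \<Longrightarrow> u \<in> S \<Longrightarrow> (D k has_real_derivative D (Suc k) u) (at u)"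
    and k: "k < n" "u \<in> S"
  shows "((deriv ^^ k) F has_real_derivative (deriv ^^ Suc k) F u) (at u)"
proof -
  have "((deriv ^^ k) F has_real_derivative D (Suc k) u) (at u)"
    by (rule has_field_derivative_transform_within_open[OF D[OF k] \<open>open S\<close>])
       (use k iterated_deriv_eq[OF assms(1-3), of n k] in auto)
  then show ?thesis
    using iterated_deriv_eq[OF assms(1-3), of n "Suc k" u] k by auto
qed

section \<open>The rational function carrying the nonlinear dependence on \<open>u\<close>\<close>

text \<open>The list holds a function of \<open>u\<close> and its first three derivatives, indexed
  so that all orders can be treated at once. The identity \<open>u * (t - 1) = D - 1\<close> has
  been used to let \<open>t\<close> enter the first two derivatives only through
  \<open>D\<close>.\<close>

definition quad_ratio :: "real \<Rightarrow> nat \<Rightarrow> real \<Rightarrow> real" where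
  "quad_ratio t k u = (let D = 1 - u + u * t in
     [u\<^sup>2 / D, u * (1 + D) / D\<^sup>2, 2 / D ^ 3, - 6 * (t - 1) / D ^ 4] ! k)"

lemma quad_ratio_simps:
  "quad_ratio t 0 u = u\<^sup>2 / (1 - u + u * t)"
  "quad_ratio t 1 u = u * (1 + (1 - u + u * t)) / (1 - u + u * t)\<^sup>2"
  "quad_ratio t 2 u = 2 / (1 - u + u * t) ^ 3"
  "quad_ratio t 3 u = - 6 * (t - 1) / (1 - u + u * t) ^ 4"
  by (simp_all add: quad_ratio_def Let_def numeral_eq_Suc)

lemma convex_combination_one_pos:
  fixes t u :: real
  assumes "0 < t" "0 \<le> u" "u \<le> 1"
  shows "0 < 1 - u + u * t"
proof (cases "u = 1")
  case False
  then have "0 < 1 - u" "0 \<le> u * t" using assms by auto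
  then show ?thesis by linarith
qed (use assms in auto)

lemma quad_ratio_has_real_derivative:
  assumes "0 < t" "0 \<le> u" "u \<le> 1" "k < 3"
  shows "(quad_ratio t k has_real_derivative quad_ratio t (Suc k) u) (at u within S)"
proof -
  have D: "1 - u + u * t \<noteq> 0" using convex_combination_one_pos[OF assms(1-3)] by simp
  have k: "k = 0 \<or> k = 1 \<or> k = 2" using assms by auto
  have "(quad_ratio t 0 has_real_derivative quad_ratio t 1 u) (at u within S)"
    unfolding quad_ratio_simps[abs_def]
    apply (rule derivative_eq_intros refl D)+
    using D by (simp add: divide_simps) algebra
  moreover have "(quad_ratio t 1 has_real_derivative quad_ratio t 2 u) (at u within S)"
    unfolding quad_ratio_simps[abs_def]
    apply (rule derivative_eq_intros refl D | simp add: D)+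
    using D by (simp add: divide_simps) algebra
  moreover have "(quad_ratio t 2 has_real_derivative quad_ratio t 3 u) (at u within S)"
    unfolding quad_ratio_simps[abs_def]
    apply (rule derivative_eq_intros refl D | simp add: D)+
    using D by (simp add: divide_simps) algebra
  ultimately show ?thesis using k by (auto simp: numeral_eq_Suc)
qed

lemma quad_ratio_measurable:
  assumes [measurable]: "t \<in> borel_measurable M" and "k \<le> 3"
  shows "(\<lambda>y. quad_ratio (t y) k u) \<in> borel_measurable M"
proof -
  have "k = 0 \<or> k = 1 \<or> k = 2 \<or> k = 3" using assms by auto
  then show ?thesis
    by (elim disjE) (simp_all only: quad_ratio_simps, measurable)
qed

text \<open>For \<open>t > 0\<close> the denominator is at least \<open>1 - u \<ge> 1 - b\<close>,
  whatever \<open>t\<close> is, which settles orders 0 to 2. Order 3 has the factor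
  \<open>t - 1\<close>, unbounded in \<open>t\<close>, and is controlled only away from
  \<open>u = 0\<close>.\<close>

lemma quad_ratio_bounded:
  assumes "0 < a" "b < 1"
  shows "\<exists>C. \<forall>t u k. 0 < t \<longrightarrow> 0 \<le> u \<longrightarrow> u \<le> b \<longrightarrow> k \<le> 3 \<longrightarrow> (k = 3 \<longrightarrow> a \<le> u) \<longrightarrow>
     \<bar>quad_ratio t k u\<bar> \<le> C"
proof -
  define e where "e = 1 - b"
  have e: "0 < e" using assms by (simp add: e_def)
  \<comment> \<open>The summands are nonnegative bounds for the orders 0, 1, 2 and 3.\<close>
  define C where "C = 1 / e + (1 / e\<^sup>2 + 1 / e) + 2 / e ^ 3 + 6 * ((1 / e + 1) / a) / e ^ 3"
  show ?thesis
  proof (intro exI[of _ C] allI impI)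
    fix t u :: real and k :: nat
    assume t: "0 < t" and u: "0 \<le> u" "u \<le> b" and k: "k \<le> 3" "k = 3 \<longrightarrow> a \<le> u"
    define D where "D = 1 - u + u * t"
    have "0 \<le> u * t" using t u by simp
    then have De: "e \<le> D" unfolding D_def e_def using u by linarith
    have D: "0 < D" using De e by linarith
    have inv: "1 / D ^ m \<le> 1 / e ^ m" for m
      using De e by (intro divide_left_mono power_mono mult_pos_pos zero_less_power) auto
    have inv1: "1 / D \<le> 1 / e" using inv[of 1] by simp
    have u1: "u \<le> 1" using u assms by simp
    have c0: "\<bar>quad_ratio t 0 u\<bar> \<le> 1 / e"
    proof -
      have "\<bar>quad_ratio t 0 u\<bar> = u\<^sup>2 / D" using D by (simp add: quad_ratio_simps D_def[symmetric])
      also have "\<dots> \<le> 1 / D" using D u u1 by (intro divide_right_mono) (auto simp: power_le_one)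
      finally show ?thesis using inv1 by simp
    qed
    have c1: "\<bar>quad_ratio t 1 u\<bar> \<le> 1 / e\<^sup>2 + 1 / e"
    proof -
      have "\<bar>quad_ratio t 1 u\<bar> = u * (1 + D) / D\<^sup>2"
        unfolding quad_ratio_simps(2) D_def[symmetric] using D u by simp
      also have "\<dots> \<le> 1 * (1 + D) / D\<^sup>2" using D u u1
        by (intro divide_right_mono mult_right_mono) auto
      also have "\<dots> = 1 / D\<^sup>2 + 1 / D" using D by (simp add: field_simps power2_eq_square)
      finally show ?thesis using inv1 inv[of 2] by simp
    qed
    have c2: "\<bar>quad_ratio t 2 u\<bar> \<le> 2 / e ^ 3"
      using inv[of 3] D by (simp add: quad_ratio_simps(3) D_def[symmetric])
    have c3: "\<bar>quad_ratio t 3 u\<bar> \<le> 6 * ((1 / e + 1) / a) / e ^ 3" if "a \<le> u"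
    proof -
      \<comment> \<open>Since \<open>u * (t - 1) = D - 1\<close>, the factor \<open>t - 1\<close>
        grows at most like \<open>(1 + D) / a\<close>, which one of the four factors
        \<open>1 / D\<close> absorbs.\<close>
      have "u * \<bar>t - 1\<bar> = \<bar>u * (t - 1)\<bar>" using u by (simp add: abs_mult)
      also have "u * (t - 1) = D - 1" by (simp add: D_def algebra_simps)
      also have "\<bar>D - 1\<bar> \<le> 1 + D" using D by simp
      finally have *: "u * \<bar>t - 1\<bar> \<le> 1 + D" .
      have "a * \<bar>t - 1\<bar> \<le> u * \<bar>t - 1\<bar>" using that by (intro mult_right_mono) auto
      with * have "\<bar>t - 1\<bar> \<le> (1 + D) / a" using assms by (simp add: field_simps)
      then have "\<bar>t - 1\<bar> / D \<le> (1 + D) / a / D" using D by (intro divide_right_mono) auto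
      also have "\<dots> = (1 / D + 1) / a" using D assms by (simp add: field_simps)
      also have "\<dots> \<le> (1 / e + 1) / a" using inv1 assms by (intro divide_right_mono) auto
      finally have **: "\<bar>t - 1\<bar> / D \<le> (1 / e + 1) / a" .
      have "\<bar>quad_ratio t 3 u\<bar> = 6 * (\<bar>t - 1\<bar> / D) * (1 / D ^ 3)"
        unfolding quad_ratio_simps(4) D_def[symmetric]
        using D by (simp only: abs_mult abs_divide) (simp add: power4_eq_xxxx power3_eq_cube)
      also have "\<dots> \<le> 6 * ((1 / e + 1) / a) * (1 / e ^ 3)"
        using ** inv[of 3] D e assms by (intro mult_mono) auto
      finally show ?thesis by simp
    qed
    have pos: "0 \<le> 1 / e" "0 \<le> 1 / e\<^sup>2 + 1 / e" "0 \<le> 2 / e ^ 3" "0 \<le> 6 * ((1 / e + 1) / a) / e ^ 3"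
      using e assms by auto
    have "k = 0 \<or> k = 1 \<or> k = 2 \<or> k = 3" using k by auto
    then show "\<bar>quad_ratio t k u\<bar> \<le> C"
    proof (elim disjE)
      assume "k = 0"
      then show ?thesis unfolding C_def using c0 pos by (simp only:)
    next
      assume "k = 1"
      then show ?thesis unfolding C_def using c1 pos by (simp only:)
    next
      assume "k = 2"
      then show ?thesis unfolding C_def using c2 pos by (simp only:)
    next
      assume "k = 3"
      moreover from this have "a \<le> u" using k by simp
      note c3[OF this]
      ultimately show ?thesis unfolding C_def using pos by (simp only:)
    qed
  qed
qed

section \<open>Integrals of \<open>quad_ratio\<close> against an integrable weight: continuity and
  derivatives in \<open>u\<close>\<close>

lemma continuous_on_integral_dominated:
  fixes h :: "real \<Rightarrow> 'a \<Rightarrow> real"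
  assumes cont: "\<And>y. continuous_on S (\<lambda>v. h v y)"
    and meas: "\<And>v. v \<in> S \<Longrightarrow> h v \<in> borel_measurable M"
    and bound: "\<And>v y. v \<in> S \<Longrightarrow> \<bar>h v y\<bar> \<le> B y"
    and B: "integrable M B"
  shows "continuous_on S (\<lambda>v. \<integral>y. h v y \<partial>M)"
  unfolding continuous_on_sequentially comp_def
proof (intro allI ballI impI, elim conjE)
  fix X :: "nat \<Rightarrow> real" and u
  assume u: "u \<in> S" and X: "\<forall>n. X n \<in> S" and lim: "X \<longlonglongrightarrow> u"
  show "(\<lambda>n. \<integral>y. h (X n) y \<partial>M) \<longlonglongrightarrow> (\<integral>y. h u y \<partial>M)"
  proof (rule integral_dominated_convergence[OF _ _ B])
    show "AE y in M. (\<lambda>n. h (X n) y) \<longlonglongrightarrow> h u y"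
      using cont u X lim unfolding continuous_on_sequentially comp_def by blast
  qed (use meas bound u X in auto)
qed

text \<open>The denominator is a convex combination of 1 and \<open>t\<close>, so its inverse is at
  most the larger of 1 and \<open>1 / t\<close>. Unlike the previous bound this one depends on
  \<open>t\<close>, but it reaches \<open>u = 1\<close>.\<close>

lemma quad_ratio_0_le:
  assumes "0 < t" "0 \<le> u" "u \<le> 1"
  shows "\<bar>quad_ratio t 0 u\<bar> \<le> 1 + 1 / t"
proof -
  have D: "0 < 1 - u + u * t" by (rule convex_combination_one_pos[OF assms])
  have "\<bar>quad_ratio t 0 u\<bar> = u\<^sup>2 / (1 - u + u * t)" unfolding quad_ratio_simps(1) using D by simp
  also have "\<dots> \<le> 1 / (1 - u + u * t)"
    using D assms by (intro divide_right_mono) (auto simp: power_le_one)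
  also have "\<dots> \<le> 1 + 1 / t"
  proof (cases "1 \<le> t")
    case True
    then have "u * 1 \<le> u * t" using assms by (intro mult_left_mono) auto
    then have "1 / (1 - u + u * t) \<le> 1" using D by simp
    moreover have "0 \<le> 1 / t" using assms by simp
    ultimately show ?thesis by linarith
  next
    case False
    then have "(1 - u) * t \<le> (1 - u) * 1" using assms by (intro mult_left_mono) auto
    then have "t \<le> 1 - u + u * t" by (simp add: algebra_simps)
    then have "1 / (1 - u + u * t) \<le> 1 / t" using assms D by (intro divide_left_mono) auto
    then show ?thesis by linarith
  qed
  finally show ?thesis .
qed

context
  fixes M :: "'a measure" and E t :: "'a \<Rightarrow> real"
  assumes E: "integrable M E" and t [measurable]: "t \<in> borel_measurable M"
    and t_pos: "\<And>y. 0 < t y"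
begin

lemma integrable_quad_ratio:
  assumes "0 \<le> u" "u < 1" "k \<le> 3" "k = 3 \<longrightarrow> 0 < u"
  shows "integrable M (\<lambda>y. E y * quad_ratio (t y) k u)"
proof -
  \<comment> \<open>The uniform bound wants a positive \<open>a\<close>. At \<open>u = 0\<close>
    order 3 is excluded, so any positive value does.\<close>
  define a where "a = (if u = 0 then 1 else u)"
  have "0 < a" using assms by (auto simp: a_def)
  from quad_ratio_bounded[OF this \<open>u < 1\<close>] obtain C where C:
     "\<forall>t v k. 0 < t \<longrightarrow> 0 \<le> v \<longrightarrow> v \<le> u \<longrightarrow> k \<le> 3 \<longrightarrow> (k = 3 \<longrightarrow> a \<le> v) \<longrightarrow>
        \<bar>quad_ratio t k v\<bar> \<le> C" ..
  have C: "\<bar>quad_ratio s k u\<bar> \<le> C" if "0 < s" for s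
    by (rule C[rule_format, OF that]) (use assms in \<open>auto simp: a_def\<close>)
  show ?thesis
  proof (rule Bochner_Integration.integrable_bound)
    show "integrable M (\<lambda>y. C * E y)" using E by simp
    show "AE y in M. norm (E y * quad_ratio (t y) k u) \<le> norm (C * E y)"
    proof (rule AE_I2)
      fix y
      have "\<bar>quad_ratio (t y) k u\<bar> \<le> \<bar>C\<bar>" using C[OF t_pos[of y]] by linarith
      then show "norm (E y * quad_ratio (t y) k u) \<le> norm (C * E y)"
        by (simp add: abs_mult mult.commute[of "\<bar>C\<bar>"] mult_left_mono)
    qed
    show "(\<lambda>y. E y * quad_ratio (t y) k u) \<in> borel_measurable M"
      by (intro borel_measurable_times borel_measurable_integrable E quad_ratio_measurable t assms)
  qed
qed

text \<open>The dominating function comes from the next order \<open>Suc k\<close>. For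
  \<open>k = 2\<close> that is order 3, bounded only for \<open>u \<ge> a\<close>, hence the left
  endpoint depending on \<open>k\<close>.\<close>

lemma integral_quad_ratio_has_real_derivative:
  assumes "k < 3" "0 < a" "b < 1" "(if k = 2 then a else 0) \<le> u" "u \<le> b"
  shows "((\<lambda>u. \<integral>y. E y * quad_ratio (t y) k u \<partial>M) has_real_derivative
           (\<integral>y. E y * quad_ratio (t y) (Suc k) u \<partial>M)) (at u within {(if k = 2 then a else 0)..b})"
proof -
  from quad_ratio_bounded[OF assms(2,3)] obtain C where C:
    "\<forall>t u k. 0 < t \<longrightarrow> 0 \<le> u \<longrightarrow> u \<le> b \<longrightarrow> k \<le> 3 \<longrightarrow> (k = 3 \<longrightarrow> a \<le> u) \<longrightarrow>
        \<bar>quad_ratio t k u\<bar> \<le> C" ..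
  have S: "0 \<le> v" "v < 1" "v \<le> b" "k = 2 \<longrightarrow> a \<le> v"
    if "v \<in> {(if k = 2 then a else 0)..b}" for v
    using that assms by (auto split: if_splits)
  show ?thesis
  proof (rule has_real_derivative_integral_dominated[where B = "\<lambda>y. \<bar>E y\<bar> * C"])
    show "(\<lambda>y. E y * quad_ratio (t y) (Suc k) u) \<in> borel_measurable M"
      using assms E quad_ratio_measurable[OF t, of "Suc k" u] by (intro borel_measurable_times) auto
    show "integrable M (\<lambda>y. \<bar>E y\<bar> * C)" using E by simp
    show "u \<in> {(if k = 2 then a else 0)..b}" using assms by simp
  next
    fix v assume "v \<in> {(if k = 2 then a else 0)..b}"
    note v = S[OF this]
    show "integrable M (\<lambda>y. E y * quad_ratio (t y) k v)"
      using v assms by (intro integrable_quad_ratio) auto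
    fix y
    show "((\<lambda>v. E y * quad_ratio (t y) k v) has_real_derivative E y * quad_ratio (t y) (Suc k) v)
        (at v within {(if k = 2 then a else 0)..b})"
      using v assms by (intro DERIV_cmult quad_ratio_has_real_derivative t_pos) auto
    show "\<bar>E y * quad_ratio (t y) (Suc k) v\<bar> \<le> \<bar>E y\<bar> * C"
      unfolding abs_mult using v assms t_pos by (intro mult_left_mono C[rule_format]) auto
  qed simp
qed

lemma integral_quad_ratio_has_real_derivative_at:
  assumes "k < 3" "0 < u" "u < 1"
  shows "((\<lambda>u. \<integral>y. E y * quad_ratio (t y) k u \<partial>M) has_real_derivative
           (\<integral>y. E y * quad_ratio (t y) (Suc k) u \<partial>M)) (at u)"
proof -
  \<comment> \<open>An admissible interval with \<open>u\<close> in its interior turns the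
    derivative within \<open>S\<close> into a two-sided one.\<close>
  define S where "S = {(if k = 2 then u / 2 else 0)..(1 + u) / 2}"
  have "u \<in> interior S"
    unfolding S_def using assms by (auto simp: field_simps)
  then have "at u within S = at u" by (rule at_within_interior)
  moreover have "((\<lambda>u. \<integral>y. E y * quad_ratio (t y) k u \<partial>M) has_real_derivative
           (\<integral>y. E y * quad_ratio (t y) (Suc k) u \<partial>M)) (at u within S)"
    unfolding S_def using assms by (intro integral_quad_ratio_has_real_derivative) auto
  ultimately show ?thesis by (simp only:)
qed

text \<open>The bounds blow up as \<open>u\<close> tends to 1, so continuity is proved locally: near
  a given \<open>u < 1\<close> the half-open interval coincides with \<open>{0..b}\<close> for some
  \<open>b\<close> strictly between \<open>u\<close> and 1.\<close>

lemma continuous_on_integral_quad_ratio: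
  assumes "k < 3"
  shows "continuous_on {0..<1} (\<lambda>u. \<integral>y. E y * quad_ratio (t y) k u \<partial>M)"
proof -
  have "continuous (at u within {0..<1}) (\<lambda>u. \<integral>y. E y * quad_ratio (t y) k u \<partial>M)"
    if u: "u \<in> {0..<1}" for u
  proof -
    define b where "b = (1 + u) / 2"
    have b: "u < b" "b < 1" using u by (auto simp: b_def)
    from quad_ratio_bounded[OF zero_less_one b(2)] obtain C where C:
      "\<forall>t u k. 0 < t \<longrightarrow> 0 \<le> u \<longrightarrow> u \<le> b \<longrightarrow> k \<le> 3 \<longrightarrow> (k = 3 \<longrightarrow> 1 \<le> u) \<longrightarrow>
        \<bar>quad_ratio t k u\<bar> \<le> C" ..
    have "continuous_on {0..b} (\<lambda>u. \<integral>y. E y * quad_ratio (t y) k u \<partial>M)"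
    proof (rule continuous_on_integral_dominated[where B = "\<lambda>y. \<bar>E y\<bar> * C"])
      show "integrable M (\<lambda>y. \<bar>E y\<bar> * C)" using E by simp
      show "(\<lambda>y. E y * quad_ratio (t y) k v) \<in> borel_measurable M" for v
        using assms E quad_ratio_measurable[OF t, of k v] by (intro borel_measurable_times) auto
      show "continuous_on {0..b} (\<lambda>v. E y * quad_ratio (t y) k v)" for y
        using assms b t_pos
        by (intro continuous_on_mult_left DERIV_continuous_on[where D = "quad_ratio (t y) (Suc k)"]
            quad_ratio_has_real_derivative) auto
      show "\<bar>E y * quad_ratio (t y) k v\<bar> \<le> \<bar>E y\<bar> * C" if "v \<in> {0..b}" for v y
        unfolding abs_mult using that assms t_pos by (intro mult_left_mono C[rule_format]) auto
    qed
    then have "continuous (at u within {0..b}) (\<lambda>u. \<integral>y. E y * quad_ratio (t y) k u \<partial>M)"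
      using u b by (auto simp: continuous_on_eq_continuous_within)
    moreover have "at u within {0..b} = at u within {0..<1}"
      by (rule at_within_nhd[of u "{..<b}"]) (use u b in auto)
    ultimately show ?thesis by simp
  qed
  then show ?thesis by (simp add: continuous_on_eq_continuous_within)
qed

text \<open>At \<open>u = 1\<close> the integrand is \<open>E y / t y\<close>, and \<open>t\<close>
  may come arbitrarily close to 0; its integrability supplies the second half of the dominating
  function.\<close>

lemma continuous_on_integral_quad_ratio_0:
  assumes Et: "integrable M (\<lambda>y. E y / t y)"
  shows "continuous_on {0..1} (\<lambda>u. \<integral>y. E y * quad_ratio (t y) 0 u \<partial>M)"
proof (rule continuous_on_integral_dominated[where B = "\<lambda>y. \<bar>E y\<bar> + \<bar>E y / t y\<bar>"])
  show "integrable M (\<lambda>y. \<bar>E y\<bar> + \<bar>E y / t y\<bar>)"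
    using E Et by (intro Bochner_Integration.integrable_add integrable_abs)
  show "(\<lambda>y. E y * quad_ratio (t y) 0 v) \<in> borel_measurable M" for v
    using E quad_ratio_measurable[OF t, of 0 v] by (intro borel_measurable_times) auto
  show "continuous_on {0..1} (\<lambda>v. E y * quad_ratio (t y) 0 v)" for y
    using t_pos
    by (intro continuous_on_mult_left DERIV_continuous_on[where D = "quad_ratio (t y) (Suc 0)"]
        quad_ratio_has_real_derivative) auto
  show "\<bar>E y * quad_ratio (t y) 0 v\<bar> \<le> \<bar>E y\<bar> + \<bar>E y / t y\<bar>" if "v \<in> {0..1}" for v y
  proof -
    have "\<bar>E y * quad_ratio (t y) 0 v\<bar> \<le> \<bar>E y\<bar> * (1 + 1 / t y)"
      unfolding abs_mult using that t_pos by (intro mult_left_mono quad_ratio_0_le) auto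
    then show ?thesis using t_pos[of y] by (simp add: distrib_left)
  qed
qed

end


section \<open>The Taylor expansion of the integrated function\<close>

text \<open>At \<open>u = 0\<close> the orders 0, 1, 2 of \<open>quad_ratio\<close> take the values
  0, 0, 2. Hence the affine part alone gives the value and slope at 0, and half the second
  derivative is the integral of \<open>E\<close>.\<close>

lemma integral_quad_ratio_Taylor:
  fixes M :: "'a measure" and A0 A1 E t :: "'a \<Rightarrow> real"
  assumes A0: "integrable M A0" and A1: "integrable M A1" and E: "integrable M E"
    and t: "t \<in> borel_measurable M" "\<And>y. 0 < t y" and Et: "integrable M (\<lambda>y. E y / t y)"
    and F: "\<And>u. u \<in> {0..1} \<Longrightarrow>
      F u = (\<integral>y. A0 y + A1 y * u + E y * (u\<^sup>2 / (1 - u + u * t y)) \<partial>M)"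
  shows "(\<forall>k<3. \<forall>u\<in>{0<..<1}.
            ((deriv ^^ k) F has_real_derivative (deriv ^^ Suc k) F u) (at u)) \<and>
         (\<exists>\<xi>\<in>{0<..<1}. F 1 = (\<integral>y. A0 y + A1 y \<partial>M) + (\<integral>y. E y \<partial>M)
            + 1 / 6 * (deriv ^^ 3) F \<xi>)"
proof -
  define G where "G k u = (\<integral>y. E y * quad_ratio (t y) k u \<partial>M)" for k u
  \<comment> \<open>Candidate for the derivative of order \<open>k\<close>: the list differentiates
    the affine part, \<open>G k\<close> the rest.\<close>
  define D where "D k u = ([integral\<^sup>L M A0 + integral\<^sup>L M A1 * u, integral\<^sup>L M A1, 0, 0] ! k) + G k u"
    for k u
  have int0: "integrable M (\<lambda>y. E y * quad_ratio (t y) 0 u)" if "u \<in> {0..1}" for u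
  proof (cases "u = 1")
    case False
    then show ?thesis using that by (intro integrable_quad_ratio E t) auto
  qed (use Et in \<open>simp add: quad_ratio_simps(1)\<close>)
  have F0: "F u = D 0 u" if "u \<in> {0..1}" for u
    using A0 A1 int0[OF that] by (simp add: F[OF that] D_def G_def quad_ratio_simps(1))
  have der: "(D k has_real_derivative D (Suc k) u) (at u)" if "k < 3" "u \<in> {0<..<1}" for k u
  proof -
    have "(G k has_real_derivative G (Suc k) u) (at u)"
      unfolding G_def[abs_def] using that by (intro integral_quad_ratio_has_real_derivative_at E t) auto
    moreover have "((\<lambda>u. [integral\<^sup>L M A0 + integral\<^sup>L M A1 * u, integral\<^sup>L M A1, 0, 0] ! k)
        has_real_derivative [integral\<^sup>L M A0 + integral\<^sup>L M A1 * u, integral\<^sup>L M A1, 0, 0] ! Suc k) (at u)"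
    proof -
      have "k = 0 \<or> k = 1 \<or> k = 2" using that by auto
      then show ?thesis by (auto intro!: derivative_eq_intros)
    qed
    ultimately show ?thesis unfolding D_def[abs_def] by (rule DERIV_add[rotated])
  qed
  have F_eq: "F u = D 0 u" if "u \<in> {0<..<1}" for u using F0 that by auto
  have "continuous_on {0..1} (G 0)" "continuous_on {0..<1} (G 1)" "continuous_on {0..<1} (G 2)"
    unfolding G_def[abs_def]
    by (intro continuous_on_integral_quad_ratio continuous_on_integral_quad_ratio_0 E Et t; simp)+
  then have cont: "continuous_on {0..1} (D 0)" "continuous_on {0..<1} (D 1)"
      "continuous_on {0..<1} (D 2)"
    by (auto simp: D_def[abs_def] intro!: continuous_intros)
  have "\<exists>\<xi>\<in>{0<..<1}. D 0 1 = D 0 0 + D 1 0 + D 2 0 / 2 + D 3 \<xi> / 6"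
  proof (rule Taylor_Lagrange_order3_unit_interval[OF cont])
    fix u :: real assume u: "u \<in> {0<..<1}"
    show "(D 0 has_real_derivative D 1 u) (at u)" using der[OF _ u, of 0] by simp
    show "(D 1 has_real_derivative D 2 u) (at u)" using der[OF _ u, of 1] by (simp add: numeral_2_eq_2)
    show "(D 2 has_real_derivative D 3 u) (at u)" using der[OF _ u, of 2] by simp
  qed
  then obtain \<xi> where \<xi>: "\<xi> \<in> {0<..<1}" "D 0 1 = D 0 0 + D 1 0 + D 2 0 / 2 + D 3 \<xi> / 6"
    by blast
  have "D 3 \<xi> = (deriv ^^ 3) F \<xi>"
    by (rule sym, rule iterated_deriv_eq[OF _ F_eq der order_refl \<xi>(1)]) simp
  moreover have "D 0 0 + D 1 0 = (\<integral>y. A0 y + A1 y \<partial>M)"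
    using A0 A1 by (simp add: D_def G_def quad_ratio_simps(1) quad_ratio_simps(2)[simplified])
  moreover have "D 2 0 / 2 = (\<integral>y. E y \<partial>M)"
    using E by (simp add: D_def G_def quad_ratio_simps(3))
  ultimately have "F 1 = (\<integral>y. A0 y + A1 y \<partial>M) + (\<integral>y. E y \<partial>M) + 1 / 6 * (deriv ^^ 3) F \<xi>"
    using \<xi> F0[of 1] by simp
  moreover have "((deriv ^^ k) F has_real_derivative (deriv ^^ Suc k) F u) (at u)"
    if "k < 3" "u \<in> {0<..<1}" for k u
    by (rule has_real_derivative_iterated_deriv[OF _ F_eq der that]) simp
  ultimately show ?thesis using \<xi> by blast
qed

section \<open>Fubini's theorem with \<open>y\<close>, the last coordinate of a nested product,
  integrated outermost\<close>

lemma measurable_lborel_prod_assoc: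
  "(\<lambda>((a, b), c). (a, b, c)) \<in> (lborel :: (('a::euclidean_space \<times> 'b::euclidean_space) \<times>
     'c::euclidean_space) measure) \<rightarrow>\<^sub>M (lborel :: ('a \<times> 'b \<times> 'c) measure)"
  unfolding lborel_prod[symmetric] case_prod_beta' by measurable

text \<open>Tuples nest to the right, so splitting off the last coordinate requires reassociation. A
  sigma-finite product measure is determined by rectangles, and on \<open>A \<times> B\<close>
  Tonelli with \<open>a\<close> innermost separates the factor of \<open>A\<close>.\<close>

lemma lborel_prod_assoc:
  "distr (lborel :: (('a::euclidean_space \<times> 'b::euclidean_space) \<times> 'c::euclidean_space) measure)
     lborel (\<lambda>((a, b), c). (a, b, c)) = lborel" (is "distr ?N _ ?g = _")
proof -
  note g = measurable_lborel_prod_assoc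
  have "lborel \<Otimes>\<^sub>M (lborel :: ('b \<times> 'c) measure) = distr ?N lborel ?g"
  proof (rule pair_measure_eqI)
    fix A :: "'a set" and B :: "('b \<times> 'c) set"
    assume A: "A \<in> sets lborel" and B: "B \<in> sets lborel"
    have B' [measurable]: "B \<in> sets (lborel \<Otimes>\<^sub>M lborel)" using B by (simp only: lborel_prod)
    note [measurable] = A
    have AB: "A \<times> B \<in> sets (lborel :: ('a \<times> 'b \<times> 'c) measure)"
      using pair_measureI[OF A B] by (simp only: lborel_prod)
    interpret P: pair_sigma_finite "(lborel :: 'a measure) \<Otimes>\<^sub>M (lborel :: 'b measure)" "lborel :: 'c measure"
      unfolding lborel_prod ..
    have "emeasure (distr ?N lborel ?g) (A \<times> B) = (\<integral>\<^sup>+z. indicator (A \<times> B) (?g z) \<partial>?N)"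
      using AB by (subst nn_integral_distr[OF g, symmetric]) simp_all
    also have "\<dots> = (\<integral>\<^sup>+z. indicator A (fst (fst z)) * indicator B (snd (fst z), snd z)
        \<partial>((lborel \<Otimes>\<^sub>M lborel) \<Otimes>\<^sub>M lborel))"
      unfolding lborel_prod
      by (intro nn_integral_cong) (auto split: prod.split simp: indicator_def)
    also have "\<dots> = (\<integral>\<^sup>+c. \<integral>\<^sup>+p. indicator A (fst p) * indicator B (snd p, c)
        \<partial>(lborel \<Otimes>\<^sub>M lborel) \<partial>lborel)"
      by (subst P.nn_integral_snd[symmetric]) simp_all
    also have "\<dots> = (\<integral>\<^sup>+c. \<integral>\<^sup>+b. \<integral>\<^sup>+a. indicator A a * indicator B (b, c) \<partial>lborel \<partial>lborel \<partial>lborel)"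
      by (subst lborel_pair.nn_integral_snd[symmetric]) simp_all
    also have "\<dots> = emeasure lborel A * (\<integral>\<^sup>+c. \<integral>\<^sup>+b. indicator B (b, c) \<partial>lborel \<partial>lborel)"
      using A by (simp add: nn_integral_multc nn_integral_cmult)
    also have "(\<integral>\<^sup>+c. \<integral>\<^sup>+b. indicator B (b, c) \<partial>lborel \<partial>lborel) = emeasure (lborel \<Otimes>\<^sub>M lborel) B"
      by (subst lborel_pair.nn_integral_snd) (simp_all add: nn_integral_indicator[OF B'])
    finally show "emeasure lborel A * emeasure lborel B = emeasure (distr ?N lborel ?g) (A \<times> B)"
      by (simp add: lborel_prod)
  qed (simp_all only: lborel_prod sets_distr sigma_finite_lborel)
  then show ?thesis by (simp add: lborel_prod)
qed

lemma integrable_lborel_assoc: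
  fixes h :: "'a::euclidean_space \<times> 'b::euclidean_space \<times> 'c::euclidean_space \<Rightarrow> real"
  assumes "integrable lborel h"
  shows "integrable lborel (\<lambda>((a, b), c). h (a, b, c))"
    and "(\<integral>z. h z \<partial>lborel) = (\<integral>((a, b), c). h (a, b, c) \<partial>lborel)"
proof -
  note g = measurable_lborel_prod_assoc
  have h: "h \<in> borel_measurable lborel" using assms by simp
  show "integrable lborel (\<lambda>((a, b), c). h (a, b, c))"
    using assms integrable_distr_eq[OF g h] unfolding lborel_prod_assoc
    by (simp add: case_prod_beta')
  show "(\<integral>z. h z \<partial>lborel) = (\<integral>((a, b), c). h (a, b, c) \<partial>lborel)"
    using integral_distr[OF g h] unfolding lborel_prod_assoc
    by (simp add: case_prod_beta')
qed

lemma Fubini_snd_lborel: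
  fixes h :: "'a::euclidean_space \<times> 'b::euclidean_space \<Rightarrow> real"
  assumes "integrable lborel h"
  shows "AE y in lborel. integrable lborel (\<lambda>x. h (x, y))"
    and "integrable lborel (\<lambda>y. \<integral>x. h (x, y) \<partial>lborel)"
    and "(\<integral>z. h z \<partial>lborel) = (\<integral>y. (\<integral>x. h (x, y) \<partial>lborel) \<partial>lborel)"
proof -
  have h: "integrable (lborel \<Otimes>\<^sub>M lborel) (\<lambda>(x, y). h (x, y))"
    using assms by (simp add: lborel_prod)
  show "AE y in lborel. integrable lborel (\<lambda>x. h (x, y))" by (rule lborel_pair.AE_integrable_snd[OF h])
  show "integrable lborel (\<lambda>y. \<integral>x. h (x, y) \<partial>lborel)" by (rule lborel_pair.integrable_snd[OF h])
  show "(\<integral>z. h z \<partial>lborel) = (\<integral>y. (\<integral>x. h (x, y) \<partial>lborel) \<partial>lborel)"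
    using lborel_pair.integral_snd[OF h] by (simp add: lborel_prod)
qed

lemma Fubini_lborel_3:
  fixes h :: "real \<times> real \<times> real \<Rightarrow> real"
  assumes "integrable lborel h"
  shows "AE y in lborel. integrable lborel (\<lambda>(a, b). h (a, b, y))"
    and "integrable lborel (\<lambda>y. \<integral>(a, b). h (a, b, y) \<partial>lborel)"
    and "(\<integral>z. h z \<partial>lborel) = (\<integral>y. (\<integral>(a, b). h (a, b, y) \<partial>lborel) \<partial>lborel)"
  using Fubini_snd_lborel[OF integrable_lborel_assoc(1)[OF assms]] integrable_lborel_assoc(2)[OF assms]
  by (simp_all add: case_prod_beta')

text \<open>Three reassociations isolate \<open>y\<close>. The remaining quadruple is then
  left-nested and is regrouped into two pairs, the shape in which the integrand of \<open>H2\<close>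
  factorizes.\<close>

lemma Fubini_lborel_5:
  fixes h :: "real \<times> real \<times> real \<times> real \<times> real \<Rightarrow> real"
  assumes h: "integrable lborel h"
  shows "AE y in lborel. integrable lborel (\<lambda>((a, b), (c, d)). h (a, b, c, d, y))"
    and "integrable lborel (\<lambda>y. \<integral>((a, b), (c, d)). h (a, b, c, d, y) \<partial>lborel)"
    and "(\<integral>z. h z \<partial>lborel) = (\<integral>y. (\<integral>((a, b), (c, d)). h (a, b, c, d, y) \<partial>lborel) \<partial>lborel)"
proof -
  define k where "k = (\<lambda>(((a, b), c), d). \<lambda>y. h (a, b, c, d, y))"
  have k1: "integrable lborel (\<lambda>(p, c, d, y). k ((p, c), d) y)"
    and k1': "(\<integral>z. h z \<partial>lborel) = (\<integral>(p, c, d, y). k ((p, c), d) y \<partial>lborel)"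
    using integrable_lborel_assoc[OF h] by (simp_all add: k_def case_prod_beta')
  have k2: "integrable lborel (\<lambda>(q, d, y). k (q, d) y)"
    and k2': "(\<integral>(p, c, d, y). k ((p, c), d) y \<partial>lborel) = (\<integral>(q, d, y). k (q, d) y \<partial>lborel)"
    using integrable_lborel_assoc[OF k1] by (simp_all add: case_prod_beta')
  have k3: "integrable lborel (\<lambda>(q, y). k q y)"
    and k3': "(\<integral>(q, d, y). k (q, d) y \<partial>lborel) = (\<integral>(q, y). k q y \<partial>lborel)"
    using integrable_lborel_assoc[OF k2] by (simp_all add: case_prod_beta')
  \<comment> \<open>Stated for measurable functions because a section of \<open>h\<close> is
    integrable only for almost every \<open>y\<close>, while the rewriting below must hold for every
    \<open>y\<close>.\<close>
  have inner: "integrable lborel (k1 \<circ> (\<lambda>((p, c), d). (p, c, d))) \<longleftrightarrow> integrable lborel k1"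
    "(\<integral>z. (k1 \<circ> (\<lambda>((p, c), d). (p, c, d))) z \<partial>lborel) = (\<integral>z. k1 z \<partial>lborel)"
    if "k1 \<in> borel_measurable lborel" for k1 :: "(real \<times> real) \<times> real \<times> real \<Rightarrow> real"
    using integrable_distr_eq[OF measurable_lborel_prod_assoc that]
      integral_distr[OF measurable_lborel_prod_assoc that]
    unfolding lborel_prod_assoc by (simp_all add: comp_def)
  have [measurable]: "h \<in> borel_measurable borel" using h by simp
  have "(\<lambda>((a, b), (c, d)). h (a, b, c, d, y)) \<in> borel_measurable lborel" for y
    unfolding lborel_prod[symmetric] case_prod_beta' by measurable
  note inner = inner[OF this]
  have comp: "(\<lambda>((a, b), (c, d)). h (a, b, c, d, y)) \<circ> (\<lambda>((p, c), d). (p, c, d)) = (\<lambda>q. k q y)" for y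
    by (auto simp: k_def fun_eq_iff)
  note inner = inner[unfolded comp]
  note F = Fubini_snd_lborel[OF k3, unfolded prod.case]
  show "AE y in lborel. integrable lborel (\<lambda>((a, b), (c, d)). h (a, b, c, d, y))"
    using F(1) unfolding inner .
  show "integrable lborel (\<lambda>y. \<integral>((a, b), (c, d)). h (a, b, c, d, y) \<partial>lborel)"
    using F(2) unfolding inner .
  show "(\<integral>z. h z \<partial>lborel) = (\<integral>y. (\<integral>((a, b), (c, d)). h (a, b, c, d, y) \<partial>lborel) \<partial>lborel)"
    using F(3) unfolding inner k1' k2' k3' .
qed

lemma integral_lborel_times:
  fixes g1 :: "'a::euclidean_space \<Rightarrow> real" and g2 :: "'b::euclidean_space \<Rightarrow> real"
  assumes "integrable lborel (\<lambda>(x, y). g1 x * g2 y)"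
  shows "(\<integral>(x, y). g1 x * g2 y \<partial>lborel) = (\<integral>x. g1 x \<partial>lborel) * (\<integral>y. g2 y \<partial>lborel)"
  using Fubini_snd_lborel(3)[OF assms] by simp

section \<open>Inner integrals at a fixed \<open>y\<close>\<close>

text \<open>A constant factor leaves the Bochner integral even when the section is not integrable,
  both sides then being 0.\<close>

lemma integral_T_integrand_section:
  "(\<integral>(xi, xj). T_integrand \<psi> (xi, xj, y) \<partial>lborel) = m_i \<psi> y * m_j \<psi> y * marginal_y \<psi> y"
proof -
  have "(\<integral>(xi, xj). T_integrand \<psi> (xi, xj, y) \<partial>lborel)
      = (\<integral>z. (m_i \<psi> y * m_j \<psi> y) * (case z of (xi, xj) \<Rightarrow> \<psi> (xi, xj, y)) \<partial>lborel)"
    by (intro Bochner_Integration.integral_cong) (auto simp: T_integrand_def)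
  then show ?thesis by (simp add: marginal_y_def)
qed

text \<open>The numerators of \<open>m_i\<close> and \<open>m_j\<close>: unlike the quotients they
  are linear on functions with integrable sections, so they pass through \<open>mix\<close>.\<close>

abbreviation mom_i :: "(real \<times> real \<times> real \<Rightarrow> real) \<Rightarrow> real \<Rightarrow> real" where
  "mom_i \<psi> y \<equiv> (\<integral>(xi, xj). xi * \<psi> (xi, xj, y) \<partial>(lborel :: (real \<times> real) measure))"

abbreviation mom_j :: "(real \<times> real \<times> real \<Rightarrow> real) \<Rightarrow> real \<Rightarrow> real" where
  "mom_j \<psi> y \<equiv> (\<integral>(xi, xj). xj * \<psi> (xi, xj, y) \<partial>(lborel :: (real \<times> real) measure))"

context
  fixes f g :: "real \<times> real \<times> real \<Rightarrow> real" and y :: real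
  assumes f: "integrable lborel (\<lambda>(xi, xj). f (xi, xj, y))"
    and xi_f: "integrable lborel (\<lambda>(xi, xj). xi * f (xi, xj, y))"
    and xj_f: "integrable lborel (\<lambda>(xi, xj). xj * f (xi, xj, y))"
begin

lemma integral_H1_integrand_section:
  "(\<integral>(xi, xj). H1_integrand f g (xi, xj, y) \<partial>lborel)
     = mom_i f y * m_j g y + mom_j f y * m_i g y - m_i g y * m_j g y * marginal_y f y"
proof -
  have "(\<integral>(xi, xj). H1_integrand f g (xi, xj, y) \<partial>lborel)
    = (\<integral>z. m_j g y * (case z of (xi, xj) \<Rightarrow> xi * f (xi, xj, y))
         + m_i g y * (case z of (xi, xj) \<Rightarrow> xj * f (xi, xj, y))
         - (m_i g y * m_j g y) * (case z of (xi, xj) \<Rightarrow> f (xi, xj, y)) \<partial>lborel)"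
    by (intro Bochner_Integration.integral_cong) (auto simp: H1_integrand_def H1_def algebra_simps)
  also have "\<dots> = m_j g y * mom_i f y + m_i g y * mom_j f y - (m_i g y * m_j g y) * marginal_y f y"
    using f xi_f xj_f by (simp add: marginal_y_def)
  finally show ?thesis by (simp add: mult.commute)
qed

lemma integral_H2_integrand_section:
  assumes "integrable lborel (\<lambda>((xi1, xj1), (xi2, xj2)). H2_integrand f g (xi1, xj1, xi2, xj2, y))"
  shows "(\<integral>((xi1, xj1), (xi2, xj2)). H2_integrand f g (xi1, xj1, xi2, xj2, y) \<partial>lborel)
     = (mom_i f y - m_i g y * marginal_y f y) * (mom_j f y - m_j g y * marginal_y f y) / marginal_y g y"
proof -
  \<comment> \<open>At fixed \<open>y\<close> the integrand is a product of a function of the first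
    pair and one of the second; \<open>g1\<close> takes the factor
    \<open>1 / marginal_y g y\<close>.\<close>
  define g1 where "g1 = (\<lambda>z. 1 / marginal_y g y *
    ((case z of (xi, xj) \<Rightarrow> xi * f (xi, xj, y)) - m_i g y * (case z of (xi, xj) \<Rightarrow> f (xi, xj, y))))"
  define g2 where "g2 = (\<lambda>z. (case z of (xi, xj) \<Rightarrow> xj * f (xi, xj, y))
    - m_j g y * (case z of (xi, xj) \<Rightarrow> f (xi, xj, y)))"
  have eq: "(\<lambda>((xi1, xj1), (xi2, xj2)). H2_integrand f g (xi1, xj1, xi2, xj2, y))
      = (\<lambda>(z1, z2). g1 z1 * g2 z2)"
    by (auto simp: fun_eq_iff H2_integrand_def H2_def g1_def g2_def algebra_simps
        add_divide_distrib diff_divide_distrib)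
  have "(\<integral>z. g1 z \<partial>lborel) = (mom_i f y - m_i g y * marginal_y f y) / marginal_y g y"
    using f xi_f by (simp add: g1_def marginal_y_def)
  moreover have "(\<integral>z. g2 z \<partial>lborel) = mom_j f y - m_j g y * marginal_y f y"
    using f xj_f by (simp add: g2_def marginal_y_def)
  ultimately show ?thesis
    using integral_lborel_times[of g1 g2] assms unfolding eq by simp
qed

text \<open>With \<open>N\<close> the marginal of the mixture, the numerator of its
  \<open>m_i\<close> is \<open>m_i g y * N\<close> plus \<open>u\<close> times
  \<open>mom_i f y - m_i g y * marginal_y f y\<close>, and likewise for \<open>m_j\<close>. Dividing
  the product of both by \<open>N\<close> leaves an affine part in \<open>u\<close> and a multiple
  of \<open>u\<^sup>2 / N\<close>.\<close>

lemma integral_T_integrand_mix_section: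
  assumes g: "integrable lborel (\<lambda>(xi, xj). g (xi, xj, y))"
    and xi_g: "integrable lborel (\<lambda>(xi, xj). xi * g (xi, xj, y))"
    and xj_g: "integrable lborel (\<lambda>(xi, xj). xj * g (xi, xj, y))"
    and pos: "0 < marginal_y f y" "0 < marginal_y g y" and u: "0 \<le> u" "u \<le> 1"
  defines "A0 \<equiv> m_i g y * m_j g y * marginal_y g y"
  shows "(\<integral>(xi, xj). T_integrand (mix f g u) (xi, xj, y) \<partial>lborel)
     = A0 + (mom_i f y * m_j g y + mom_j f y * m_i g y - m_i g y * m_j g y * marginal_y f y - A0) * u
       + (mom_i f y - m_i g y * marginal_y f y) * (mom_j f y - m_j g y * marginal_y f y) / marginal_y g y
         * (u\<^sup>2 / (1 - u + u * (marginal_y f y / marginal_y g y)))"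
proof -
  define p q where "p = marginal_y f y" and "q = marginal_y g y"
  define c d where "c = mom_i g y" and "d = mom_j g y"
  have lin: "(\<integral>z. u * k z + (1 - u) * l z \<partial>lborel) = u * (\<integral>z. k z \<partial>lborel) + (1 - u) * (\<integral>z. l z \<partial>lborel)"
    if "integrable lborel k" "integrable lborel l" for k l :: "real \<times> real \<Rightarrow> real"
    using that by simp
  have q: "marginal_y (mix f g u) y = u * p + (1 - u) * q"
    using lin[OF f g] by (simp add: marginal_y_def p_def q_def mix_def case_prod_beta')
  have mi: "m_i (mix f g u) y = (u * mom_i f y + (1 - u) * c) / (u * p + (1 - u) * q)"
    using lin[OF xi_f xi_g] unfolding m_i_def q c_def
    by (simp add: mix_def case_prod_beta' algebra_simps)
  have mj: "m_j (mix f g u) y = (u * mom_j f y + (1 - u) * d) / (u * p + (1 - u) * q)"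
    using lin[OF xj_f xj_g] unfolding m_j_def q d_def
    by (simp add: mix_def case_prod_beta' algebra_simps)
  have pq: "0 < p" "0 < q" using pos by (simp_all add: p_def q_def)
  have mg: "m_i g y = c / q" "m_j g y = d / q" by (simp_all add: m_i_def m_j_def c_def d_def q_def)
  define \<gamma> \<delta> where "\<gamma> = c / q" and "\<delta> = d / q"
  define N where "N = u * p + (1 - u) * q"
  have N_eq: "N = q * (1 - u + u * (p / q))" using pq by (simp add: N_def field_simps)
  have N: "N \<noteq> 0"
    using convex_combination_one_pos[of "p / q" u] pq u by (simp add: N_eq)
  have cd: "c = \<gamma> * q" "d = \<delta> * q" using pq by (simp_all add: \<gamma>_def \<delta>_def)
  have "(u * mom_i f y + (1 - u) * c) / N * ((u * mom_j f y + (1 - u) * d) / N) * N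
      = (u * mom_i f y + (1 - u) * c) * (u * mom_j f y + (1 - u) * d) / N"
    using N by simp
  \<comment> \<open>Polynomial division by \<open>N\<close>, with remainder a multiple of
    \<open>u\<^sup>2\<close>.\<close>
  also have "(u * mom_i f y + (1 - u) * c) * (u * mom_j f y + (1 - u) * d)
      = (\<gamma> * \<delta> * q + (mom_i f y * \<delta> + mom_j f y * \<gamma> - \<gamma> * \<delta> * p - \<gamma> * \<delta> * q) * u) * N
        + (mom_i f y - \<gamma> * p) * (mom_j f y - \<delta> * p) * u\<^sup>2"
    unfolding N_def cd by algebra
  also have "\<dots> / N = \<gamma> * \<delta> * q + (mom_i f y * \<delta> + mom_j f y * \<gamma> - \<gamma> * \<delta> * p - \<gamma> * \<delta> * q) * u
        + (mom_i f y - \<gamma> * p) * (mom_j f y - \<delta> * p) * (u\<^sup>2 / N)"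
    using N by (simp add: add_divide_distrib)
  also have "u\<^sup>2 / N = 1 / q * (u\<^sup>2 / (1 - u + u * (p / q)))"
    unfolding N_eq by simp
  finally show ?thesis
    unfolding integral_T_integrand_section mi mj q A0_def mg p_def[symmetric] q_def[symmetric]
      N_def[symmetric] \<gamma>_def[symmetric] \<delta>_def[symmetric] by simp
qed

end

text \<open>Up to a null set the mixture is \<open>(1 - u)\<close> times \<open>g\<close>, and the
  inner integral is homogeneous of degree one. The case \<open>u = 1\<close> is covered since
  \<open>0 / 0 = 0\<close>.\<close>

lemma integral_T_integrand_mix_section_null:
  fixes f g :: "real \<times> real \<times> real \<Rightarrow> real"
  assumes [measurable]: "f \<in> borel_measurable borel" "g \<in> borel_measurable borel"
    and null: "AE z in lborel. (case z of (xi, xj) \<Rightarrow> f (xi, xj, y)) = 0"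
  shows "(\<integral>(xi, xj). T_integrand (mix f g u) (xi, xj, y) \<partial>lborel)
     = (1 - u) * (m_i g y * m_j g y * marginal_y g y)"
proof -
  have [measurable]: "(\<lambda>z. f (fst z, snd z, y)) \<in> borel_measurable borel"
    "(\<lambda>z. g (fst z, snd z, y)) \<in> borel_measurable borel"
    unfolding borel_prod[symmetric] by measurable
  \<comment> \<open>The weights 1, \<open>fst\<close> and \<open>snd\<close> give the marginal and
    the two numerators.\<close>
  have eq: "(\<integral>(xi, xj). w (xi, xj) * mix f g u (xi, xj, y) \<partial>lborel)
      = (1 - u) * (\<integral>(xi, xj). w (xi, xj) * g (xi, xj, y) \<partial>lborel)"
    if [measurable]: "w \<in> borel_measurable borel" for w :: "real \<times> real \<Rightarrow> real"
  proof -
    have "(\<integral>(xi, xj). w (xi, xj) * mix f g u (xi, xj, y) \<partial>lborel)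
        = (\<integral>z. (1 - u) * (case z of (xi, xj) \<Rightarrow> w (xi, xj) * g (xi, xj, y)) \<partial>lborel)"
    proof (rule integral_cong_AE)
      show "AE z in lborel. (case z of (xi, xj) \<Rightarrow> w (xi, xj) * mix f g u (xi, xj, y))
          = (1 - u) * (case z of (xi, xj) \<Rightarrow> w (xi, xj) * g (xi, xj, y))"
        using null by eventually_elim (auto simp: mix_def)
    qed (simp_all add: mix_def case_prod_beta')
    then show ?thesis by simp
  qed
  have "marginal_y (mix f g u) y = (1 - u) * marginal_y g y"
    using eq[of "\<lambda>_. 1"] by (simp add: marginal_y_def)
  moreover have "(\<integral>(xi, xj). xi * mix f g u (xi, xj, y) \<partial>(lborel :: (real \<times> real) measure))
      = (1 - u) * (\<integral>(xi, xj). xi * g (xi, xj, y) \<partial>lborel)"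
    using eq[of fst] by (simp add: borel_measurable_continuous_onI continuous_on_fst)
  moreover have "(\<integral>(xi, xj). xj * mix f g u (xi, xj, y) \<partial>(lborel :: (real \<times> real) measure))
      = (1 - u) * (\<integral>(xi, xj). xj * g (xi, xj, y) \<partial>lborel)"
    using eq[of snd] by (simp add: borel_measurable_continuous_onI continuous_on_snd)
  ultimately show ?thesis
    unfolding integral_T_integrand_section by (simp add: m_i_def m_j_def)
qed

section \<open>The decomposition, for densities and then for random vectors\<close>

text \<open>Isolates the analytic content: of the probabilistic setting only measurability,
  positivity and integrability remain.\<close>

lemma decomposition_of_densities:
  fixes f g :: "real \<times> real \<times> real \<Rightarrow> real"
  assumes f_meas [measurable]: "f \<in> borel_measurable borel"
    and g_meas [measurable]: "g \<in> borel_measurable borel"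
    and f_nonneg: "\<And>z. 0 \<le> f z" and f_int: "integrable lborel f"
    and xi_f: "integrable lborel (\<lambda>(xi, xj, y). xi * f (xi, xj, y))"
    and xj_f: "integrable lborel (\<lambda>(xi, xj, y). xj * f (xi, xj, y))"
    and g_pos: "AE y in lborel. 0 < marginal_y f y \<longrightarrow>
           0 < marginal_y g y \<and>
           integrable lborel (\<lambda>(xi, xj). xi * g (xi, xj, y)) \<and>
           integrable lborel (\<lambda>(xi, xj). xj * g (xi, xj, y))"
    and T: "\<And>u. u \<in> {0..1} \<Longrightarrow> integrable lborel (T_integrand (mix f g u))"
    and H1: "integrable lborel (H1_integrand f g)"
    and H2: "integrable lborel (H2_integrand f g)"
  shows "(\<forall>k<3. \<forall>u\<in>{0<..<1}.
            ((deriv ^^ k) (F_path f g) has_real_derivative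
             (deriv ^^ Suc k) (F_path f g) u) (at u)) \<and>
         (\<exists>\<xi>\<in>{0<..<1}.
            T_ij f = (\<integral>z. H1_integrand f g z \<partial>lborel)
                   + (\<integral>w. H2_integrand f g w \<partial>lborel)
                   + Gamma_rem f g \<xi>)"
proof -
  define A0 where "A0 y = m_i g y * m_j g y * marginal_y g y" for y
  define H where "H y = (\<integral>(xi, xj). H1_integrand f g (xi, xj, y) \<partial>lborel)" for y
  define E where "E y = (\<integral>((xi1, xj1), (xi2, xj2)). H2_integrand f g (xi1, xj1, xi2, xj2, y) \<partial>lborel)" for y
  \<comment> \<open>The default 1 keeps \<open>t\<close> positive everywhere. It is harmless because
    \<open>E\<close> vanishes almost everywhere on the set where it applies.\<close>
  define t where "t y = (if 0 < marginal_y f y \<and> 0 < marginal_y g y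
    then marginal_y f y / marginal_y g y else 1)" for y
  define \<phi> where "\<phi> u y = (\<integral>(xi, xj). T_integrand (mix f g u) (xi, xj, y) \<partial>lborel)" for u y
  have mix_0: "mix f g 0 = g" and mix_1: "mix f g 1 = f" by (simp_all add: mix_def)
  have A0: "integrable lborel A0"
    using Fubini_lborel_3(2)[OF T[of 0]] unfolding integral_T_integrand_section
    by (simp add: A0_def[abs_def] mix_0)
  have H: "integrable lborel H" unfolding H_def[abs_def] by (rule Fubini_lborel_3(2)[OF H1])
  have E: "integrable lborel E" unfolding E_def[abs_def] by (rule Fubini_lborel_5(2)[OF H2])
  have marg [measurable]: "marginal_y \<psi> \<in> borel_measurable borel"
    if [measurable]: "\<psi> \<in> borel_measurable borel" for \<psi>
  proof -
    have [measurable]: "\<psi> \<in> borel_measurable (borel \<Otimes>\<^sub>M borel \<Otimes>\<^sub>M borel)"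
      using that by (simp add: borel_prod)
    have "sigma_finite_measure ((lborel :: real measure) \<Otimes>\<^sub>M (lborel :: real measure))"
      unfolding lborel_prod by (rule sigma_finite_lborel)
    then have "(\<lambda>y. \<integral>z. \<psi> (fst z, snd z, y) \<partial>(lborel \<Otimes>\<^sub>M lborel)) \<in> borel_measurable borel"
      by (rule sigma_finite_measure.borel_measurable_lebesgue_integral) measurable
    then show ?thesis unfolding lborel_prod by (simp add: marginal_y_def[abs_def] case_prod_beta')
  qed
  have t: "t \<in> borel_measurable lborel" unfolding t_def[abs_def] using f_meas g_meas by simp
  have t_pos: "0 < t y" for y by (simp add: t_def)

  have \<phi>: "AE y in lborel. \<forall>u\<in>{0..1}.
      \<phi> u y = A0 y + (H y - A0 y) * u + E y * (u\<^sup>2 / (1 - u + u * t y))"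
    using Fubini_lborel_3(1)[OF f_int] Fubini_lborel_3(1)[OF xi_f] Fubini_lborel_3(1)[OF xj_f]
      Fubini_lborel_5(1)[OF H2] g_pos
  proof eventually_elim
    case (elim y)
    then have fy: "integrable lborel (\<lambda>(xi, xj). f (xi, xj, y))"
      "integrable lborel (\<lambda>(xi, xj). xi * f (xi, xj, y))"
      "integrable lborel (\<lambda>(xi, xj). xj * f (xi, xj, y))" by simp_all
    note Hy = integral_H1_integrand_section[OF fy, of g, folded H_def]
    note Ey = integral_H2_integrand_section[OF fy elim(4), folded E_def]
    show ?case
    proof (cases "0 < marginal_y f y")
      case True
      with elim(5) have q: "0 < marginal_y g y"
        and gy: "integrable lborel (\<lambda>(xi, xj). xi * g (xi, xj, y))"
          "integrable lborel (\<lambda>(xi, xj). xj * g (xi, xj, y))" by auto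
      \<comment> \<open>A non-integrable function has integral 0, so a positive marginal already
        gives integrability.\<close>
      from q have "integrable lborel (\<lambda>(xi, xj). g (xi, xj, y))"
        unfolding marginal_y_def using not_integrable_integral_eq by fastforce
      from integral_T_integrand_mix_section[OF fy this gy True q] show ?thesis
        using True q by (simp add: Hy Ey \<phi>_def A0_def t_def)
    next
      case False
      moreover have "0 \<le> marginal_y f y"
        unfolding marginal_y_def by (rule Bochner_Integration.integral_nonneg) (auto simp: f_nonneg)
      ultimately have p: "marginal_y f y = 0" by simp
      have null: "AE z in lborel. (case z of (xi, xj) \<Rightarrow> f (xi, xj, y)) = 0"
        using p integral_nonneg_eq_0_iff_AE[OF fy(1)] f_nonneg
        unfolding marginal_y_def by (auto simp: case_prod_beta')
      have "(\<integral>(xi, xj). xi * f (xi, xj, y) \<partial>(lborel :: (real \<times> real) measure)) = 0"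
        "(\<integral>(xi, xj). xj * f (xi, xj, y) \<partial>(lborel :: (real \<times> real) measure)) = 0"
        by (rule integral_eq_zero_AE, use null in eventually_elim, auto)+
      then have "H y = 0" "E y = 0" unfolding Hy Ey p by simp_all
      then show ?thesis
        using integral_T_integrand_mix_section_null[OF f_meas g_meas null]
        by (simp add: \<phi>_def A0_def algebra_simps)
    qed
  qed
  \<comment> \<open>At \<open>u = 1\<close> the formula for \<phi> reads
    \<open>H y + E y / t y\<close>, whose left side is integrable by Fubini.\<close>
  have Et: "integrable lborel (\<lambda>y. E y / t y)"
  proof (rule integrable_cong_AE_imp)
    show "integrable lborel (\<lambda>y. \<phi> 1 y - H y)"
      unfolding \<phi>_def using Fubini_lborel_3(2)[OF T[of 1]] H by simp
    show "(\<lambda>y. E y / t y) \<in> borel_measurable lborel" using E t by measurable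
    show "AE y in lborel. \<phi> 1 y - H y = E y / t y"
      using \<phi> by eventually_elim simp
  qed
  have F: "F_path f g u = (\<integral>y. A0 y + (H y - A0 y) * u + E y * (u\<^sup>2 / (1 - u + u * t y)) \<partial>lborel)"
    if u: "u \<in> {0..1}" for u
  proof -
    have "F_path f g u = (\<integral>y. \<phi> u y \<partial>lborel)"
      unfolding F_path_def T_ij_def \<phi>_def by (rule Fubini_lborel_3(3)[OF T[OF u]])
    also have "\<dots> = (\<integral>y. A0 y + (H y - A0 y) * u + E y * (u\<^sup>2 / (1 - u + u * t y)) \<partial>lborel)"
    proof (rule integral_cong_AE)
      show "\<phi> u \<in> borel_measurable lborel"
        unfolding \<phi>_def[abs_def] using Fubini_lborel_3(2)[OF T[OF u]] by simp
      show "(\<lambda>y. A0 y + (H y - A0 y) * u + E y * (u\<^sup>2 / (1 - u + u * t y))) \<in> borel_measurable lborel"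
        using A0 H E t by measurable
    qed (use \<phi> u in auto)
    finally show ?thesis .
  qed
  \<comment> \<open>The slope is \<open>H y - A0 y\<close>, so value plus slope at 0 integrate to
    the \<open>H1\<close> term.\<close>
  have "integrable lborel (\<lambda>y. H y - A0 y)" using H A0 by simp
  from integral_quad_ratio_Taylor[OF A0 this E t t_pos Et F]
  have "(\<forall>k<3. \<forall>u\<in>{0<..<1}.
            ((deriv ^^ k) (F_path f g) has_real_derivative (deriv ^^ Suc k) (F_path f g) u) (at u)) \<and>
         (\<exists>\<xi>\<in>{0<..<1}. F_path f g 1 = (\<integral>y. H y \<partial>lborel) + (\<integral>y. E y \<partial>lborel)
            + 1 / 6 * (deriv ^^ 3) (F_path f g) \<xi>)"
    by simp
  moreover have "F_path f g 1 = T_ij f" by (simp add: F_path_def mix_1)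
  moreover have "(\<integral>y. H y \<partial>lborel) = (\<integral>z. H1_integrand f g z \<partial>lborel)"
    unfolding H_def by (rule Fubini_lborel_3(3)[OF H1, symmetric])
  moreover have "(\<integral>y. E y \<partial>lborel) = (\<integral>w. H2_integrand f g w \<partial>lborel)"
    unfolding E_def by (rule Fubini_lborel_5(3)[OF H2, symmetric])
  ultimately show ?thesis unfolding Gamma_rem_def by simp
qed

theorem proposition1:
  fixes M :: "'a measure"
    and X :: "'a \<Rightarrow> real ^ 'p" and Y :: "'a \<Rightarrow> real" and i j :: 'p
    and f fhat :: "real \<times> real \<times> real \<Rightarrow> real"
    and n n\<^sub>1 :: nat and I :: "nat set"
    and Z :: "nat \<Rightarrow> 'a \<Rightarrow> real \<times> real \<times> real"
    and est :: "(nat \<Rightarrow> real \<times> real \<times> real) \<Rightarrow> real \<times> real \<times> real \<Rightarrow> real"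
    and \<omega> :: 'a
  assumes "prob_space M"
    and "X \<in> borel_measurable M" and "Y \<in> borel_measurable M"
    and "integrable M (\<lambda>s. (norm (X s))\<^sup>2)"
    and "(\<integral>s. X s \<partial>M) = 0"
    and "i \<noteq> j"
    \<comment> \<open>bounded joint density\<close>
    and "distributed M lborel (\<lambda>s. (X s $ i, X s $ j, Y s)) (\<lambda>z. ennreal (f z))"
    and "\<And>z. 0 \<le> f z" and "bounded (range f)"
    \<comment> \<open>\<open>fhat\<close> is a realization of an estimator built from a subsample\<close>
    and "iid_sample M (\<lambda>s. (X s $ i, X s $ j, Y s)) n Z"
    and "I \<subseteq> {..<n}" and "card I = n\<^sub>1" and "n\<^sub>1 < n"
    and "case_prod est \<in> borel_measurable ((\<Pi>\<^sub>M k\<in>I. borel) \<Otimes>\<^sub>M borel)"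
    and "\<omega> \<in> space M" and "fhat = est (\<lambda>k\<in>I. Z k \<omega>)"
    and "bounded (range fhat)" and "integrable lborel (\<lambda>z. (fhat z)\<^sup>2)"
    \<comment> \<open>the expressions in the decomposition are well defined\<close>
    and "AE y in lborel. 0 < marginal_y f y \<longrightarrow>
           0 < marginal_y fhat y \<and>
           integrable lborel (\<lambda>(xi, xj). xi * fhat (xi, xj, y)) \<and>
           integrable lborel (\<lambda>(xi, xj). xj * fhat (xi, xj, y))"
    and "\<And>u. u \<in> {0..1} \<Longrightarrow> integrable lborel (T_integrand (mix f fhat u))"
    and "integrable lborel (H1_integrand f fhat)"
    and "integrable lborel (H2_integrand f fhat)"
  shows "(\<forall>k<3. \<forall>u\<in>{0<..<1}.
            ((deriv ^^ k) (F_path f fhat) has_real_derivative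
             (deriv ^^ Suc k) (F_path f fhat) u) (at u)) \<and>
         (\<exists>\<xi>\<in>{0<..<1}.
            T_ij f = (\<integral>z. H1_integrand f fhat z \<partial>lborel)
                   + (\<integral>w. H2_integrand f fhat w \<partial>lborel)
                   + Gamma_rem f fhat \<xi>)"
proof -
  interpret prob_space M by fact
  have dist: "distributed M lborel (\<lambda>s. (X s $ i, X s $ j, Y s)) (\<lambda>z. ennreal (f z))" by fact
  have f_nonneg: "0 \<le> f z" for z by fact
  have f_meas: "f \<in> borel_measurable borel"
    using distributed_real_measurable[OF _ dist] f_nonneg by simp
  \<comment> \<open>Coordinates are dominated by the norm, hence square integrable, hence integrable
    on a probability space; the density transfers this to \<open>xi * f\<close> and
    \<open>xj * f\<close>.\<close>
  have X_int: "integrable M (\<lambda>s. X s $ l)" for l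
  proof (rule square_integrable_imp_integrable)
    show [measurable]: "(\<lambda>s. X s $ l) \<in> borel_measurable M"
      using \<open>X \<in> borel_measurable M\<close> by (rule measurable_compose)
        (intro borel_measurable_continuous_onI continuous_intros)
    show "integrable M (\<lambda>s. (X s $ l)\<^sup>2)"
    proof (rule Bochner_Integration.integrable_bound)
      show "integrable M (\<lambda>s. (norm (X s))\<^sup>2)" by fact
      have "\<bar>X s $ l\<bar>\<^sup>2 \<le> (norm (X s))\<^sup>2" for s
        by (intro power_mono component_le_norm_cart) simp
      then show "AE s in M. norm ((X s $ l)\<^sup>2) \<le> norm ((norm (X s))\<^sup>2)" by simp
    qed measurable
  qed
  have f_int: "integrable lborel f"
    using distributed_integrable[OF dist, of "\<lambda>_. 1"] f_nonneg by simp
  have xi_f: "integrable lborel (\<lambda>(xi, xj, y). xi * f (xi, xj, y))"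
    using distributed_integrable[OF dist, of fst] f_nonneg X_int
    by (simp add: case_prod_beta' mult.commute flip: borel_prod)
  have xj_f: "integrable lborel (\<lambda>(xi, xj, y). xj * f (xi, xj, y))"
    using distributed_integrable[OF dist, of "\<lambda>z. fst (snd z)"] f_nonneg X_int
    by (simp add: case_prod_beta' mult.commute flip: borel_prod)
  \<comment> \<open>\<open>fhat\<close> is the section of the jointly measurable \<open>est\<close>
    at the observed subsample, and so is measurable.\<close>
  have "(\<lambda>k\<in>I. Z k \<omega>) \<in> space (\<Pi>\<^sub>M k\<in>I. borel)" by (simp add: space_PiM)
  from measurable_Pair2[OF \<open>case_prod est \<in> borel_measurable _\<close> this]
  have "fhat \<in> borel_measurable borel" using \<open>fhat = est (\<lambda>k\<in>I. Z k \<omega>)\<close> by simp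
  then show ?thesis
    by (rule decomposition_of_densities[OF f_meas _ f_nonneg f_int xi_f xj_f]) fact+
qed

end
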